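(* Let $b\geq 2$ be an integer and let $A=(a_n)_{n=1}^{\infty}$ be a strictly increasing sequence of positive integers. Suppose that $\eta:=\lim_{n\to\infty}\frac{a_{n+1}}{a_n}$ exists and $1<\eta<+\infty$. Then for any $\hat v\in(0,\eta)$, $$\dim_{\rm H}(\hat{\mathcal V}^{\ast}_{b,A}(\hat v))\ge\frac{\eta^{\tilde l+1}-1-\eta^{\tilde l}\hat v}{(\eta^{\tilde l+1}-1)(1+\eta^{\tilde l}\hat v)},$$ where $$\tilde l=\tilde l(\hat v):=\max\left\{1,\left\lfloor\frac{\log(\eta+1)-\log(\eta-\hat v)}{\log\eta}\right\rfloor\right\}.$$
   Context: $\|x\|$ denotes the distance from $x\in\mathbb R$ to the nearest integer; $\dim_{\rm H}$ is Hausdorff dimension; $\lfloor\cdot\rfloor$ is the floor function. For real $\xi$, $$\hat v_{b,A}(\xi):=\sup\Big\{\hat v\ge 0:\ \text{for all sufficiently large integers }N,\ \min_{1\le n\le N}\|b^{a_n}\xi\|<(b^{a_N})^{-\hat v}\Big\}\in[0,+\infty].$$ (The exponent is introduced for irrational $\xi$; for rational $\xi$ the same formula is used.) For $\hat v\in[0,\eta]$, $\hat{\mathcal V}^{\ast}_{b,A}(\hat v):=\{\xi\in\mathbb R:\hat v_{b,A}(\xi)=\hat v\}$. *)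

theory Defs
  imports "HOL-Analysis.Analysis"
begin

section \<open>Hausdorff measure and dimension\<close>

text \<open>
  The weight of a covering set of diameter \<open>d\<close> is \<open>d\<^sup>s\<close>, with the usual conventions that the empty
  set weighs nothing and that \<open>d\<^sup>0 = 1\<close> for every nonempty set. The latter needs a separate case
  because \<open>0 powr 0 = 0\<close>.
\<close>

definition hausdorff_gauge :: "real \<Rightarrow> 'a::metric_space set \<Rightarrow> ennreal" where
  "hausdorff_gauge s U =
     (if U = {} then 0 else if s = 0 then 1 else ennreal (diameter U powr s))"

text \<open>
  Boundedness is part of the notion of a cover because \<open>diameter\<close> is unspecified on unbounded sets.
  Finite covers are included by padding with empty sets.
\<close>

definition delta_cover :: "real \<Rightarrow> 'a::metric_space set \<Rightarrow> (nat \<Rightarrow> 'a set) \<Rightarrow> bool" where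
  "delta_cover \<delta> S U \<longleftrightarrow> S \<subseteq> (\<Union>i. U i) \<and> (\<forall>i. bounded (U i) \<and> diameter (U i) \<le> \<delta>)"

definition hausdorff_premeasure :: "real \<Rightarrow> real \<Rightarrow> 'a::metric_space set \<Rightarrow> ennreal" where
  "hausdorff_premeasure \<delta> s S = (INF U\<in>{U. delta_cover \<delta> S U}. \<Sum>i. hausdorff_gauge s (U i))"

definition hausdorff_measure :: "real \<Rightarrow> 'a::metric_space set \<Rightarrow> ennreal" where
  "hausdorff_measure s S = (SUP \<delta>\<in>{0<..}. hausdorff_premeasure \<delta> s S)"

definition hausdorff_dim :: "'a::metric_space set \<Rightarrow> ereal" where
  "hausdorff_dim S = Inf {ereal s | s. 0 \<le> s \<and> hausdorff_measure s S = 0}"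


section \<open>Uniform exponents along a sequence of powers\<close>

text \<open>
  Sequences are indexed from \<open>1\<close>; the value \<open>a 0\<close> plays no role below. The distance of \<open>x\<close> to the
  nearest integer is \<open>infdist x \<int>\<close>. The set in the supremum always contains \<open>0\<close>, so
  the supremum lies in \<open>[0, \<infinity>]\<close>.
\<close>

definition vhat :: "int \<Rightarrow> (nat \<Rightarrow> nat) \<Rightarrow> real \<Rightarrow> ereal" where
  "vhat b a \<xi> = Sup {ereal v | v. 0 \<le> v \<and>
     (\<forall>\<^sub>F N in sequentially.
        (MIN n\<in>{1..N}. infdist (of_int b ^ a n * \<xi>) \<int>) < (of_int b ^ a N) powr (- v))}"

definition Vhat_star :: "int \<Rightarrow> (nat \<Rightarrow> nat) \<Rightarrow> real \<Rightarrow> real set" where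
  "Vhat_star b a v = {\<xi>. vhat b a \<xi> = ereal v}"

definition ltilde :: "real \<Rightarrow> real \<Rightarrow> nat" where
  "ltilde \<eta> v = nat (max 1 \<lfloor>(ln (\<eta> + 1) - ln (\<eta> - v)) / ln \<eta>\<rfloor>)"

end

theory Submission
  imports Defs
begin

text \<open>
  Only the inequality \<open>\<eta>\<^sup>l (\<eta> - v) > 1\<close> is needed about \<open>l = ltilde \<eta> v\<close>. Choose every
  \<open>(l + 1)\<close>-st index, \<open>n\<^sub>0 < n\<^sub>1 < \<dots>\<close>, and let the digits of \<open>\<xi>\<close> in base \<open>b\<close> vanish on a block of length about
  \<open>v a(n\<^sub>k + l)\<close> that follows position \<open>a(n\<^sub>k)\<close>; by the inequality the blocks are disjoint. The block makes \<open>a(n\<^sub>k)\<close> good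
  enough for all \<open>N\<close> with \<open>n\<^sub>k \<le> N \<le> n\<^sub>k + l\<close> and for no larger exponent at \<open>N = n\<^sub>k + l\<close>, provided that a few
  more digits are fixed to keep the other \<open>b\<^bsup>a(n)\<^esup> \<xi>\<close> away from the integers. So the exponent is \<open>v\<close>, whatever the
  remaining digits are. Writing the digits of \<open>x \<in> [0, 1)\<close> into the free positions gives an
  increasing map into the set whose inverse is Hoelder with any exponent below the lower density of the
  free positions. A cover of the set pulls back to a cover of \<open>[0, 1)\<close>, whose Lebesgue measure then bounds
  the Hausdorff measure from below. The density is smallest at the ends of the blocks, where it
  tends to the stated value.
\<close>

section \<open>Lower bounds for the Hausdorff dimension\<close>

text \<open>Any two points of the preimage of \<open>U i\<close> are at distance at most
  \<open>K * diameter (U i) powr t\<close>, so the preimage fits into an interval of twice that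
  length. These intervals cover [0, 1), whose Lebesgue measure 1 forces the weights of the cover to
  sum to at least \<open>1 / (2 * K)\<close>.\<close>

lemma hausdorff_measure_neq_0_if_expanding:
  fixes g :: "real \<Rightarrow> 'a::metric_space"
  assumes t: "0 < t" and K: "0 < K"
    and exp: "\<And>x y. x \<in> {0..<1} \<Longrightarrow> y \<in> {0..<1} \<Longrightarrow> dist x y \<le> K * dist (g x) (g y) powr t"
    and sub: "g ` {0..<1} \<subseteq> S"
  shows "hausdorff_measure t S \<noteq> 0"
proof
  assume "hausdorff_measure t S = 0"
  moreover have "hausdorff_premeasure 1 t S \<le> hausdorff_measure t S"
    unfolding hausdorff_measure_def by (rule SUP_upper) auto
  ultimately have "hausdorff_premeasure 1 t S < ennreal (1 / (2 * K))"
    using K by simp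
  then obtain U where U: "delta_cover 1 S U"
    and small: "(\<Sum>i. hausdorff_gauge t (U i)) < ennreal (1 / (2 * K))"
    unfolding hausdorff_premeasure_def INF_less_iff by auto
  define V where "V i = {x \<in> {0..<1}. g x \<in> U i}" for i
  define c where "c i = (SOME x. x \<in> V i)" for i
  define r where "r i = K * diameter (U i) powr t" for i
  \<comment> \<open>Passing from the preimage \<open>V i\<close> to an interval about one of its
    points secures measurability.\<close>
  define W where "W i = (if V i = {} then {} else {c i - r i..c i + r i})" for i
  have V_W: "V i \<subseteq> W i" for i
  proof
    fix x assume x: "x \<in> V i"
    have c: "c i \<in> V i" unfolding c_def using x by (rule someI)
    have "dist (g x) (g (c i)) \<le> diameter (U i)"
      using x c U by (intro diameter_bounded_bound) (auto simp: V_def delta_cover_def)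
    then have "dist (g x) (g (c i)) powr t \<le> diameter (U i) powr t"
      using t by (intro powr_mono2) auto
    then have "dist x (c i) \<le> r i"
      using exp[of x "c i"] x c K unfolding r_def V_def
      by (smt (verit, best) mem_Collect_eq mult_left_mono)
    then show "x \<in> W i" using x by (auto simp: W_def dist_real_def)
  qed
  have W_le: "emeasure lborel (W i) \<le> ennreal (2 * K) * hausdorff_gauge t (U i)" for i
  proof (cases "V i = {}")
    case False
    then have "U i \<noteq> {}" by (auto simp: V_def)
    then have "ennreal (2 * K) * hausdorff_gauge t (U i) = ennreal (2 * r i)"
      using t K by (simp add: hausdorff_gauge_def r_def ennreal_mult[symmetric] mult.assoc)
    moreover have "0 \<le> r i" using K by (simp add: r_def)
    ultimately show ?thesis using False by (simp add: W_def)
  qed (simp add: W_def)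
  have "{0..<1} \<subseteq> (\<Union>i. W i)"
  proof
    fix x :: real assume x: "x \<in> {0..<1}"
    then obtain i where "g x \<in> U i" using sub U unfolding delta_cover_def by blast
    then show "x \<in> (\<Union>i. W i)" using x V_W[of i] by (auto simp: V_def)
  qed
  then have "emeasure lborel {0..<1::real} \<le> emeasure lborel (\<Union>i. W i)"
    by (intro emeasure_mono) (auto simp: W_def)
  also have "\<dots> \<le> (\<Sum>i. emeasure lborel (W i))"
    by (rule emeasure_subadditive_countably) (auto simp: W_def)
  also have "\<dots> \<le> (\<Sum>i. ennreal (2 * K) * hausdorff_gauge t (U i))"
    by (intro suminf_le W_le) auto
  also have "\<dots> = ennreal (2 * K) * (\<Sum>i. hausdorff_gauge t (U i))"
    by simp
  also have "\<dots> < ennreal (2 * K) * ennreal (1 / (2 * K))"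
    using small K by (intro ennreal_mult_strict_left_mono) auto
  also have "\<dots> = 1"
    using K by (simp add: ennreal_mult[symmetric])
  finally show False by simp
qed

lemma hausdorff_measure_0_neq_0:
  assumes "S \<noteq> {}"
  shows "hausdorff_measure 0 S \<noteq> 0"
proof
  assume "hausdorff_measure 0 S = 0"
  moreover have "hausdorff_premeasure 1 0 S \<le> hausdorff_measure 0 S"
    unfolding hausdorff_measure_def by (rule SUP_upper) auto
  ultimately have "hausdorff_premeasure 1 0 S < 1"
    by simp
  then obtain U where U: "delta_cover 1 S U"
    and small: "(\<Sum>i. hausdorff_gauge 0 (U i)) < 1"
    unfolding hausdorff_premeasure_def INF_less_iff by auto
  obtain i where "U i \<noteq> {}" using U assms unfolding delta_cover_def by blast
  then have "1 = (\<Sum>j\<in>{i}. hausdorff_gauge 0 (U j))"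
    by (simp add: hausdorff_gauge_def)
  also have "\<dots> \<le> (\<Sum>j. hausdorff_gauge 0 (U j))"
    by (rule sum_le_suminf) auto
  finally show False using small by simp
qed

text \<open>The exponents in (0, \<open>s\<close>) are excluded from the infimum by hypothesis, the
  exponent 0 by nonemptiness.\<close>

lemma hausdorff_dim_geI:
  assumes "S \<noteq> {}"
    and "\<And>t. 0 < t \<Longrightarrow> t < s \<Longrightarrow> hausdorff_measure t S \<noteq> 0"
  shows "ereal s \<le> hausdorff_dim S"
  unfolding hausdorff_dim_def
proof (rule Inf_greatest, clarify)
  fix t assume t: "0 \<le> t" "hausdorff_measure t S = 0"
  then have "t \<noteq> 0" using hausdorff_measure_0_neq_0[OF assms(1)] by auto
  then show "ereal s \<le> ereal t" using t assms(2)[of t] by force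
qed


section \<open>Expansions in an integer base\<close>

text \<open>For digits in 0..b-1 this is the fractional part of
  \<open>b^m * digit_tail b d 0\<close>, except that it equals 1 if all digits after position
  \<open>m\<close> are \<open>b - 1\<close>.\<close>

definition digit_tail :: "int \<Rightarrow> (nat \<Rightarrow> int) \<Rightarrow> nat \<Rightarrow> real" where
  "digit_tail b d m = (\<Sum>i. of_int (d (Suc (m + i))) / of_int b ^ Suc i)"

primrec digit_prefix :: "int \<Rightarrow> (nat \<Rightarrow> int) \<Rightarrow> nat \<Rightarrow> int" where
  "digit_prefix b d 0 = 0"
| "digit_prefix b d (Suc p) = b * digit_prefix b d p + d (Suc p)"

locale digit_expansion =
  fixes b :: int and d :: "nat \<Rightarrow> int"
  assumes base: "2 \<le> b" and digit_nonneg: "0 \<le> d i" and digit_less: "d i < b"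
begin

lemma sums_top_digits: "(\<lambda>i. (of_int b - 1) / of_int b ^ Suc i) sums (1::real)"
proof -
  have "(\<lambda>i. (of_int b - 1) / of_int b * (1 / of_int b) ^ i) sums
      ((of_int b - 1) / of_int b * (1 / (1 - 1 / of_int b)) :: real)"
    using base by (intro sums_mult geometric_sums) simp
  moreover have "(of_int b - 1) / of_int b * (1 / (1 - 1 / of_int b)) = (1::real)"
    using base by (simp add: field_simps)
  ultimately show ?thesis by (simp add: power_one_over field_simps)
qed

lemma digit_term_le:
  "of_int (d j) / of_int b ^ Suc i \<le> (of_int b - 1) / (of_int b ^ Suc i :: real)"
  using base digit_less[of j] by (intro divide_right_mono) auto

lemma summable_digits: "summable (\<lambda>i. of_int (d (Suc (m + i))) / of_int b ^ Suc i :: real)"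
proof (rule summable_comparison_test')
  show "summable (\<lambda>i. (of_int b - 1) / of_int b ^ Suc i :: real)"
    using sums_top_digits by (rule sums_summable)
  show "norm (of_int (d (Suc (m + i))) / of_int b ^ Suc i :: real)
      \<le> (of_int b - 1) / of_int b ^ Suc i" if "i \<ge> 0" for i
    using base digit_nonneg[of "Suc (m + i)"] digit_term_le[of "Suc (m + i)" i]
    by (simp add: norm_divide norm_power)
qed

lemma digit_tail_nonneg: "0 \<le> digit_tail b d m"
  unfolding digit_tail_def using base digit_nonneg
  by (intro suminf_nonneg summable_digits) simp

lemma digit_tail_le_1: "digit_tail b d m \<le> 1"
proof -
  have "digit_tail b d m \<le> (\<Sum>i. (of_int b - 1) / of_int b ^ Suc i)"
    unfolding digit_tail_def using sums_top_digits
    by (intro suminf_le digit_term_le summable_digits) (rule sums_summable)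
  then show ?thesis using sums_top_digits by (simp add: sums_iff)
qed

lemma digit_tail_Suc: "of_int b * digit_tail b d m = of_int (d (Suc m)) + digit_tail b d (Suc m)"
proof -
  let ?f = "\<lambda>i. of_int (d (Suc (m + i))) / of_int b ^ Suc i :: real"
  have "digit_tail b d m = ?f 0 + (\<Sum>i. ?f (Suc i))"
    unfolding digit_tail_def using suminf_split_head[OF summable_digits[of m]] by simp
  moreover have "(\<Sum>i. ?f (Suc i)) = digit_tail b d (Suc m) / of_int b"
    unfolding digit_tail_def suminf_divide[OF summable_digits, symmetric]
    by (rule suminf_cong) (simp add: field_simps)
  ultimately show ?thesis using base by (simp add: field_simps)
qed

lemma power_mult_digit_tail_0:
  "of_int b ^ m * digit_tail b d 0 = of_int (digit_prefix b d m) + digit_tail b d m"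
proof (induction m)
  case (Suc m)
  have "of_int b ^ Suc m * digit_tail b d 0 = of_int b * (of_int b ^ m * digit_tail b d 0)"
    by simp
  also have "\<dots> = of_int b * of_int (digit_prefix b d m) + of_int b * digit_tail b d m"
    by (simp only: Suc.IH distrib_left)
  finally show ?case by (simp add: digit_tail_Suc)
qed simp

lemma digit_tail_zeros:
  assumes "\<And>i. m < i \<Longrightarrow> i \<le> m + L \<Longrightarrow> d i = 0"
  shows "digit_tail b d m \<le> 1 / of_int b ^ L"
  using assms
proof (induction L arbitrary: m)
  case (Suc L)
  have "digit_tail b d (Suc m) \<le> 1 / of_int b ^ L"
    using Suc.prems by (intro Suc.IH) auto
  then have "digit_tail b d (Suc m) / of_int b \<le> 1 / of_int b ^ L / of_int b"
    using base by (intro divide_right_mono) auto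
  moreover have "digit_tail b d m = digit_tail b d (Suc m) / of_int b"
    using digit_tail_Suc[of m] Suc.prems[of "Suc m"] base by (simp add: field_simps)
  ultimately show ?case by (simp add: mult.commute)
qed (simp add: digit_tail_le_1)

lemma digit_tail_ge:
  assumes "0 < i" "i \<le> L" "d (m + i) \<noteq> 0"
  shows "1 / of_int b ^ L \<le> digit_tail b d m"
  using assms
proof (induction L arbitrary: m i)
  case (Suc L)
  have "1 / of_int b ^ L \<le> of_int b * digit_tail b d m"
  proof (cases "i = 1")
    case True
    then have "1 \<le> d (Suc m)" using Suc.prems digit_nonneg[of "Suc m"] by simp
    then have "1 \<le> of_int b * digit_tail b d m"
      using digit_tail_Suc[of m] digit_tail_nonneg[of "Suc m"] by simp
    moreover have "1 / of_int b ^ L \<le> (1::real)"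
      using base by (simp add: divide_le_eq one_le_power)
    ultimately show ?thesis by simp
  next
    case False
    then have "1 / of_int b ^ L \<le> digit_tail b d (Suc m)"
      using Suc.prems by (intro Suc.IH[of "i - 1"]) auto
    then show ?thesis
      using digit_tail_Suc[of m] digit_nonneg[of "Suc m"] by simp
  qed
  then show ?case using base by (simp add: field_simps)
qed simp

text \<open>Complementing the digits replaces a tail by 1 minus the tail, so a lower bound for tails
  also yields an upper bound.\<close>

lemma digit_expansion_compl: "digit_expansion b (\<lambda>i. b - 1 - d i)"
proof
  show "0 \<le> b - 1 - d i" "b - 1 - d i < b" for i
    using digit_less[of i] digit_nonneg[of i] by auto
qed (rule base)

lemma digit_tail_compl: "digit_tail b (\<lambda>i. b - 1 - d i) m = 1 - digit_tail b d m"
proof -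
  have "(\<lambda>i. (of_int b - 1) / of_int b ^ Suc i - of_int (d (Suc (m + i))) / of_int b ^ Suc i)
      sums (1 - digit_tail b d m)"
    unfolding digit_tail_def
    by (intro sums_diff sums_top_digits summable_sums summable_digits)
  then show ?thesis
    unfolding digit_tail_def by (simp add: sums_iff diff_divide_distrib)
qed

lemma infdist_power_mult_le:
  "infdist (of_int b ^ m * digit_tail b d 0) \<int> \<le> digit_tail b d m"
proof -
  have "infdist (of_int b ^ m * digit_tail b d 0) \<int>
      \<le> dist (of_int b ^ m * digit_tail b d 0) (of_int (digit_prefix b d m))"
    by (rule infdist_le) simp
  also have "\<dots> = digit_tail b d m"
    using digit_tail_nonneg by (simp add: power_mult_digit_tail_0 dist_real_def)
  finally show ?thesis .
qed

text \<open>A digit other than 0 keeps the tail away from 0, a digit other than \<open>b - 1\<close>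
  keeps it away from 1.\<close>

lemma infdist_power_mult_ge:
  assumes "0 < i" "i \<le> L" "d (m + i) \<noteq> 0"
    and "0 < j" "j \<le> L" "d (m + j) \<noteq> b - 1"
  shows "1 / of_int b ^ L \<le> infdist (of_int b ^ m * digit_tail b d 0) \<int>"
proof -
  interpret compl: digit_expansion b "\<lambda>i. b - 1 - d i"
    by (rule digit_expansion_compl)
  let ?r = "1 / of_int b ^ L :: real" and ?\<tau> = "digit_tail b d m"
  have lo: "?r \<le> ?\<tau>"
    using assms by (intro digit_tail_ge[of i]) auto
  have hi: "?r \<le> 1 - ?\<tau>"
    unfolding digit_tail_compl[symmetric] using assms by (intro compl.digit_tail_ge[of j]) auto
  have "?r \<le> dist (of_int b ^ m * digit_tail b d 0) z" if z: "z \<in> \<int>" for z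
  proof -
    obtain k where k: "z = of_int k" using z by (elim Ints_cases)
    define q where "q = digit_prefix b d m - k"
    have "q \<ge> 0 \<or> q \<le> - 1" by linarith
    then have "real_of_int q \<ge> 0 \<or> real_of_int q \<le> - 1" by linarith
    then have "?r \<le> \<bar>real_of_int q + ?\<tau>\<bar>" using lo hi by linarith
    then show ?thesis by (simp add: k q_def power_mult_digit_tail_0 dist_real_def algebra_simps)
  qed
  moreover have "(\<int> :: real set) \<noteq> {}" by auto
  ultimately show ?thesis
    by (simp add: infdist_notempty cINF_greatest)
qed

end


section \<open>Spreading a real number over the free digit positions\<close>

definition free_count :: "nat set \<Rightarrow> nat \<Rightarrow> nat" where
  "free_count A p = card ({1..p} - A)"

text \<open>For \<open>x\<close> in [0, 1) the difference of floors is the base \<open>b\<close>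
  digit of \<open>x\<close> whose rank is that of \<open>p\<close> among the free positions. If
  \<open>0 \<in> A\<close>, the rank is at least 1 there, so the subtraction in the exponent is not
  truncated.\<close>

definition spread :: "int \<Rightarrow> nat set \<Rightarrow> (nat \<Rightarrow> int) \<Rightarrow> real \<Rightarrow> nat \<Rightarrow> int" where
  "spread b A e x p = (if p \<in> A then e p
     else \<lfloor>of_int b ^ free_count A p * x\<rfloor> - b * \<lfloor>of_int b ^ (free_count A p - 1) * x\<rfloor>)"

lemma free_count_0 [simp]: "free_count A 0 = 0"
  by (simp add: free_count_def)

lemma free_count_Suc:
  "free_count A (Suc p) = (if Suc p \<in> A then free_count A p else Suc (free_count A p))"
proof -
  have "{1..Suc p} - A = (if Suc p \<in> A then {1..p} - A else insert (Suc p) ({1..p} - A))"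
    by (auto simp: le_Suc_eq)
  then show ?thesis by (simp add: free_count_def)
qed

lemma floor_digit_bounds:
  fixes x :: real and b :: int
  assumes "0 < b"
  shows "b * \<lfloor>x\<rfloor> \<le> \<lfloor>of_int b * x\<rfloor>" "\<lfloor>of_int b * x\<rfloor> < b * \<lfloor>x\<rfloor> + b"
proof -
  have "of_int b * of_int \<lfloor>x\<rfloor> \<le> of_int b * x"
    using assms by (intro mult_left_mono) auto
  then show "b * \<lfloor>x\<rfloor> \<le> \<lfloor>of_int b * x\<rfloor>"
    by (simp add: le_floor_iff)
  have "of_int b * x < of_int b * (of_int \<lfloor>x\<rfloor> + 1)"
    using assms by (intro mult_strict_left_mono) auto
  then show "\<lfloor>of_int b * x\<rfloor> < b * \<lfloor>x\<rfloor> + b"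
    by (simp add: floor_less_iff algebra_simps)
qed

lemma digit_expansion_spread:
  assumes "2 \<le> b" and e: "\<And>p. 0 \<le> e p" "\<And>p. e p < b" and "0 \<in> A"
  shows "digit_expansion b (spread b A e x)"
proof -
  have "0 \<le> spread b A e x p \<and> spread b A e x p < b" for p
  proof (cases "p \<in> A")
    case False
    then obtain q where q: "p = Suc q" using assms(4) by (cases p) auto
    define c where "c = free_count A q"
    show ?thesis
      using False floor_digit_bounds[of b "of_int b ^ c * x"] assms(1)
      by (simp add: spread_def q free_count_Suc c_def[symmetric] mult.assoc)
  qed (use e in \<open>simp add: spread_def\<close>)
  then show ?thesis using assms(1) by unfold_locales auto
qed

text \<open>At a free position both differences are multiplied by \<open>b\<close> and increased by
  the same digit difference. At a position of \<open>A\<close> the digits agree, so the right side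
  is multiplied by \<open>b\<close> while the left side stays; since it is nonnegative, it can only
  grow.\<close>

lemma digit_prefix_spread_diff:
  fixes x y :: real
  assumes "2 \<le> b" "0 \<le> x" "x \<le> y" "y < 1"
  shows "\<lfloor>of_int b ^ free_count A p * y\<rfloor> - \<lfloor>of_int b ^ free_count A p * x\<rfloor>
    \<le> digit_prefix b (spread b A e y) p - digit_prefix b (spread b A e x) p"
proof (induction p)
  case 0
  have "\<lfloor>x\<rfloor> = 0" "\<lfloor>y\<rfloor> = 0" using assms by (auto simp: floor_eq_iff)
  then show ?case by simp
next
  case (Suc p)
  define c where "c = free_count A p"
  let ?D = "digit_prefix b (spread b A e y) p - digit_prefix b (spread b A e x) p"
  let ?F = "\<lfloor>of_int b ^ c * y\<rfloor> - \<lfloor>of_int b ^ c * x\<rfloor>"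
  have IH: "?F \<le> ?D" using Suc by (simp add: c_def)
  have "\<lfloor>of_int b ^ c * x\<rfloor> \<le> \<lfloor>of_int b ^ c * y\<rfloor>"
    using assms by (intro floor_mono mult_left_mono) auto
  then have D: "0 \<le> ?D" using IH by simp
  show ?case
  proof (cases "Suc p \<in> A")
    case True
    have "?D \<le> b * ?D" using D assms(1) mult_right_mono[of 1 b ?D] by simp
    then show ?thesis
      using IH True by (simp add: spread_def[where p = "Suc p"] free_count_Suc c_def algebra_simps)
  next
    case False
    have "b * ?F \<le> b * ?D" using IH assms(1) by (intro mult_left_mono) auto
    then show ?thesis
      using False by (simp add: spread_def[where p = "Suc p"] free_count_Suc c_def algebra_simps)
  qed
qed

lemma spread_expanding:
  fixes x y :: real
  assumes b: "2 \<le> b" and e: "\<And>p. 0 \<le> e p" "\<And>p. e p < b" and A: "0 \<in> A"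
    and xy: "0 \<le> x" "x \<le> y" "y < 1"
    and p: "3 \<le> of_int b ^ free_count A p * (y - x)"
  shows "1 / of_int b ^ p \<le> digit_tail b (spread b A e y) 0 - digit_tail b (spread b A e x) 0"
proof -
  interpret X: digit_expansion b "spread b A e x"
    by (rule digit_expansion_spread[OF b e A])
  interpret Y: digit_expansion b "spread b A e y"
    by (rule digit_expansion_spread[OF b e A])
  let ?F = "\<lambda>x. \<lfloor>of_int b ^ free_count A p * x\<rfloor>"
  let ?G = "\<lambda>x. digit_prefix b (spread b A e x) p"
  \<comment> \<open>Of the gap 3, rounding costs at most 1 here and the tails, which lie in [0, 1],
    cost at most 1 below.\<close>
  have "2 \<le> ?F y - ?F x" using p by (simp add: right_diff_distrib) linarith
  then have "2 \<le> ?G y - ?G x" using digit_prefix_spread_diff[OF b xy, of A p e] by simp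
  then have "1 \<le> (of_int (?G y) + digit_tail b (spread b A e y) p)
      - (of_int (?G x) + digit_tail b (spread b A e x) p)"
    using Y.digit_tail_nonneg[of p] X.digit_tail_le_1[of p] by linarith
  also have "\<dots> = of_int b ^ p *
      (digit_tail b (spread b A e y) 0 - digit_tail b (spread b A e x) 0)"
    by (simp only: X.power_mult_digit_tail_0 Y.power_mult_digit_tail_0 right_diff_distrib)
  finally show ?thesis using b by (simp add: field_simps)
qed

text \<open>The count rises by at most one per position and is unbounded by the density hypothesis,
  so it skips no value.\<close>

lemma ex_free_count_eq:
  assumes t: "0 < t" and dens: "\<And>p. t * real p \<le> real (free_count A p) + C"
  shows "\<exists>p. free_count A p = j"
proof -
  obtain q :: nat where "(real j + C) / t < real q" using reals_Archimedean2 by blast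
  then have "real j + C < t * real q" using t by (simp add: field_simps)
  then have "j \<le> free_count A q" using dens[of q] by simp
  then show ?thesis
  proof (induction q)
    case 0
    then show ?case by (intro exI[of _ 0]) simp
  next
    case (Suc q)
    show ?case
    proof (cases "j \<le> free_count A q")
      case False
      then have "free_count A (Suc q) = j" using Suc.prems by (auto simp: free_count_Suc split: if_splits)
      then show ?thesis by blast
    qed (rule Suc.IH)
  qed
qed

text \<open>If \<open>y - x\<close> is of order \<open>b^(-j)\<close>, take \<open>p\<close> with
  exactly \<open>j\<close> free positions up to it. The images then differ by at least
  \<open>b^(-p)\<close>, and the density hypothesis bounds \<open>t * p\<close> by
  \<open>j + C\<close>.\<close>

lemma spread_holder:
  fixes x y :: real
  assumes b: "2 \<le> b" and e: "\<And>p. 0 \<le> e p" "\<And>p. e p < b" and A: "0 \<in> A"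
    and t: "0 < t" and dens: "\<And>p. t * real p \<le> real (free_count A p) + C"
    and x: "x \<in> {0..<1}" and y: "y \<in> {0..<1}"
  shows "dist x y \<le> 3 * of_int b powr (1 + C) *
    dist (digit_tail b (spread b A e x) 0) (digit_tail b (spread b A e y) 0) powr t"
  using x y
proof (induction x y rule: linorder_wlog)
  case (le x y)
  let ?g = "\<lambda>x. digit_tail b (spread b A e x) 0"
  show ?case
  proof (cases "x = y")
    case False
    then have xy: "0 < y - x" using le by simp
    obtain n where "3 / (y - x) < of_int b ^ n"
      using real_arch_pow[of "of_int b"] b by auto
    then have n: "3 \<le> of_int b ^ n * (y - x)" using xy by (simp add: field_simps)
    define j where "j = (LEAST n. 3 \<le> of_int b ^ n * (y - x))"
    have j: "3 \<le> of_int b ^ j * (y - x)" unfolding j_def using n by (rule LeastI)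
    have "j \<noteq> 0" using j le by (intro notI) simp
    then obtain i where i: "j = Suc i" by (cases j) auto
    \<comment> \<open>Minimality of \<open>j\<close> bounds the distance from above, at the cost of
      one factor \<open>b\<close>; hence the constant
      \<open>3 * of_int b powr (1 + C)\<close>.\<close>
    have "\<not> 3 \<le> of_int b ^ i * (y - x)"
      unfolding j_def by (rule not_less_Least) (simp add: j_def[symmetric] i)
    then have small: "of_int b ^ j * (y - x) \<le> 3 * of_int b"
      using b by (simp add: i mult.assoc)
    obtain p where p: "free_count A p = j" using ex_free_count_eq[OF t dens] by blast
    have "1 / of_int b ^ p \<le> ?g y - ?g x"
      using le j p by (intro spread_expanding[OF b e A]) auto
    then have "(1 / of_int b ^ p) powr t \<le> dist (?g x) (?g y) powr t"
      using t b by (intro powr_mono2) (auto simp: dist_real_def)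
    moreover have "(1 / of_int b ^ p) powr t = of_int b powr (- (t * real p))"
      using b by (simp add: powr_realpow[symmetric] powr_minus_divide[symmetric] powr_powr mult.commute)
    moreover have "of_int b powr (- (real j + C)) \<le> of_int b powr (- (t * real p))"
      using dens[of p] b p by (intro powr_mono) auto
    ultimately have lb: "of_int b powr (- (real j + C)) \<le> dist (?g x) (?g y) powr t" by simp
    have "y - x \<le> 3 * of_int b / of_int b ^ j"
      using small b by (simp add: field_simps)
    also have "\<dots> = 3 * of_int b powr (1 + C) * of_int b powr (- (real j + C))"
    proof -
      have "of_int b powr (1 + C) * of_int b powr (- (real j + C)) = of_int b powr (1 - real j)"
        by (simp flip: powr_add)
      also have "\<dots> = of_int b / of_int b ^ j"
        using b by (simp add: powr_diff powr_realpow)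
      finally show ?thesis by simp
    qed
    also have "\<dots> \<le> 3 * of_int b powr (1 + C) * dist (?g x) (?g y) powr t"
      using lb by (intro mult_left_mono) auto
    finally show ?thesis using xy by (simp add: dist_real_def)
  qed simp
next
  case (sym x y)
  then show ?case by (simp add: dist_commute)
qed


section \<open>Numbers with prescribed uniform exponent\<close>

lemma strict_mono_block:
  fixes u :: "nat \<Rightarrow> nat"
  assumes "strict_mono u" "u 0 \<le> p"
  shows "\<exists>k. u k \<le> p \<and> p < u (Suc k)"
proof -
  have "\<exists>j. p < u j"
    using strict_mono_imp_increasing[OF assms(1), of "Suc p"] by (intro exI[of _ "Suc p"]) simp
  then have lt: "p < u (LEAST j. p < u j)" by (rule LeastI_ex)
  then obtain k where k: "(LEAST j. p < u j) = Suc k"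
    using assms(2) by (cases "LEAST j. p < u j") auto
  have "\<not> p < u k" using not_less_Least[of k "\<lambda>j. p < u j"] k by simp
  then show ?thesis using lt k by (intro exI[of _ k]) auto
qed

text \<open>From \<open>N\<close> on, \<open>gap\<close> leaves room for two markers after
  \<open>a n\<close>, and \<open>block_gap\<close> for a zero block with its two end markers before
  the next block starts.\<close>

locale zero_blocks =
  fixes b :: int and a :: "nat \<Rightarrow> nat" and v :: real and l N :: nat
  assumes base: "2 \<le> b" and v_pos: "0 < v" and N_pos: "0 < N"
    and a_strict: "strict_mono_on {1..} a"
    and gap: "\<And>n. N \<le> n \<Longrightarrow> a n + 2 \<le> a (Suc n)"
    and block_gap: "\<And>n. N \<le> n \<Longrightarrow> a n + nat \<lceil>v * a (n + l)\<rceil> + 2 \<le> a (n + l + 1)"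
begin

text \<open>Starting at \<open>Suc N\<close> rather than \<open>N\<close> lets \<open>gap\<close>
  apply to the predecessor of every \<open>idx k\<close> as well.\<close>

definition idx :: "nat \<Rightarrow> nat" where
  "idx k = Suc N + k * (l + 1)"

definition len :: "nat \<Rightarrow> nat" where
  "len k = nat \<lceil>v * a (idx k + l)\<rceil>"

definition zeros :: "nat set" where
  "zeros = (\<Union>k. {a (idx k)<..a (idx k) + len k})"

text \<open>
  Two consecutive markers carry the digits \<open>0\<close> and \<open>1\<close> in some order, which keeps \<open>b\<^sup>m \<xi>\<close> away from the
  integers for every \<open>m\<close> not far before them.
\<close>

definition markers :: "nat set" where
  "markers = (\<Union>n\<in>{1..}. {a n + 1, a n + 2}) \<union>
    (\<Union>k. {a (idx k) + len k + 1, a (idx k) + len k + 2})"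

text \<open>Position \<open>0\<close> carries no digit; counting it as forced avoids a case distinction.\<close>

definition forced :: "nat set" where
  "forced = insert 0 (zeros \<union> markers)"

text \<open>Where a marker falls into a zero block, the block wins. Elsewhere the parity of the
  position makes adjacent markers differ.\<close>

definition forced_digit :: "nat \<Rightarrow> int" where
  "forced_digit p = (if p \<in> zeros then 0 else int (p mod 2))"

section \<open>Arrangement of the blocks\<close>

lemma a_le: "1 \<le> m \<Longrightarrow> m \<le> n \<Longrightarrow> a m \<le> a n"
  using strict_mono_on_leD[OF a_strict, of m n] by simp

lemma a_ge: "n \<le> a (n + 1)"
proof (induction n)
  case (Suc n)
  have "a (n + 1) < a (Suc n + 1)" using strict_mono_onD[OF a_strict, of "n + 1" "Suc n + 1"] by simp
  then show ?case using Suc by simp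
qed simp

lemma idx_Suc: "idx (Suc k) = idx k + l + 1"
  by (simp add: idx_def)

lemma idx_mono: "j \<le> k \<Longrightarrow> idx j \<le> idx k"
  unfolding idx_def by (intro add_mono mult_le_mono1) auto

lemma idx_strict: "strict_mono idx"
  by (simp add: strict_mono_Suc_iff idx_Suc)

lemma idx_ge: "Suc N \<le> idx k" "1 \<le> idx k"
  by (simp_all add: idx_def)

lemma len_mono: "j \<le> k \<Longrightarrow> len j \<le> len k"
  unfolding len_def using v_pos idx_mono[of j k] idx_ge[of j] a_le[of "idx j + l" "idx k + l"]
  by (intro nat_mono ceiling_mono mult_left_mono) auto

lemma len_bounds: "v * a (idx k + l) \<le> len k" "len k \<le> v * a (idx k + l) + 1"
proof -
  have "0 \<le> v * a (idx k + l)" using v_pos by simp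
  then have "real (len k) = of_int \<lceil>v * a (idx k + l)\<rceil>" by (simp add: len_def)
  then show "v * a (idx k + l) \<le> len k" "len k \<le> v * a (idx k + l) + 1" by linarith+
qed

lemma before_idx:
  assumes "1 \<le> n" "n < idx k"
  shows "a n + 2 \<le> a (idx k)"
proof -
  obtain m where m: "idx k = Suc m" using idx_ge(2)[of k] by (cases "idx k") auto
  have "a n \<le> a m" using assms m by (intro a_le) auto
  moreover have "a m + 2 \<le> a (Suc m)" using idx_ge(1)[of k] m by (intro gap) simp
  ultimately show ?thesis using m by simp
qed

lemma block_end: "j < k \<Longrightarrow> a (idx j) + len j + 2 \<le> a (idx k)"
  using block_gap[of "idx j"] idx_ge[of j] idx_ge[of "Suc j"] idx_mono[of "Suc j" k]
    a_le[of "idx (Suc j)" "idx k"]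
  by (simp add: len_def idx_Suc)

lemma a_idx_strict: "strict_mono (\<lambda>k. a (idx k))"
  unfolding strict_mono_Suc_iff
proof
  show "a (idx k) < a (idx (Suc k))" for k using block_end[of k "Suc k"] by simp
qed

text \<open>The end markers of a block must not be overwritten by zeros; distinct blocks are far
  enough apart by \<open>block_end\<close>.\<close>

lemma after_block_not_zeros:
  assumes "p \<in> {a (idx k) + len k + 1, a (idx k) + len k + 2}"
  shows "p \<notin> zeros"
proof
  assume "p \<in> zeros"
  then obtain j where j: "a (idx j) < p" "p \<le> a (idx j) + len j" by (auto simp: zeros_def)
  consider "j < k" | "j = k" | "k < j" by linarith
  then show False using j assms block_end[of j k] block_end[of k j] by cases auto
qed

section \<open>Counting forced and free positions\<close>

lemma forced_cases:
  assumes "0 < p" "p \<in> forced"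
  obtains j where "a (idx j) < p" "p \<le> a (idx j) + len j + 2"
    | n where "1 \<le> n" "p \<in> {a n + 1, a n + 2}"
proof -
  consider j where "p \<in> {a (idx j)<..a (idx j) + len j}" | n where "1 \<le> n" "p \<in> {a n + 1, a n + 2}"
    | j where "p \<in> {a (idx j) + len j + 1, a (idx j) + len j + 2}"
    using assms unfolding forced_def zeros_def markers_def by blast
  then show thesis
  proof cases
    case (1 j)
    then show ?thesis by (intro that(1)[of j]) auto
  next
    case (2 n)
    then show ?thesis by (rule that(2))
  next
    case (3 j)
    then show ?thesis by (intro that(1)[of j]) auto
  qed
qed

lemma forced_block:
  "forced \<inter> {a (idx k)<..a (idx (Suc k))} \<subseteq> {a (idx k)<..a (idx k) + len k + 2} \<union>
    (\<Union>n\<in>{idx k..<idx (Suc k)}. {a n + 1, a n + 2})"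
proof
  fix p assume p: "p \<in> forced \<inter> {a (idx k)<..a (idx (Suc k))}"
  then have "0 < p" "p \<in> forced" by auto
  then consider j where "a (idx j) < p" "p \<le> a (idx j) + len j + 2"
    | n where "1 \<le> n" "p \<in> {a n + 1, a n + 2}"
    by (rule forced_cases)
  then show "p \<in> {a (idx k)<..a (idx k) + len k + 2} \<union>
    (\<Union>n\<in>{idx k..<idx (Suc k)}. {a n + 1, a n + 2})"
  proof cases
    case (1 j)
    have "j = k"
    proof (rule ccontr)
      assume "j \<noteq> k"
      then consider "j < k" | "Suc k \<le> j" by linarith
      then show False
      proof cases
        case 2
        then have "a (idx (Suc k)) \<le> a (idx j)" by (intro a_le idx_mono idx_ge)
        then show ?thesis using 1 p by simp
      qed (use 1 p block_end[of j k] in simp)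
    qed
    then show ?thesis using 1 by simp
  next
    case (2 n)
    have "\<not> n < idx k" using before_idx[of n k] 2 p by auto
    moreover have "\<not> idx (Suc k) \<le> n"
      using a_le[of "idx (Suc k)" n] idx_ge[of "Suc k"] 2 p by auto
    ultimately show ?thesis using 2 by auto
  qed
qed

text \<open>The block with its end markers contributes \<open>len k + 2\<close>, and each of the
  \<open>l + 1\<close> indices of the period contributes two markers.\<close>

lemma card_forced_block:
  "card (forced \<inter> {a (idx k)<..a (idx (Suc k))}) \<le> len k + 2 * l + 4"
proof -
  let ?M = "\<Union>n\<in>{idx k..<idx (Suc k)}. {a n + 1, a n + 2}"
  have "card ?M \<le> (\<Sum>n\<in>{idx k..<idx (Suc k)}. card {a n + 1, a n + 2})"
    by (rule card_UN_le) simp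
  also have "\<dots> = 2 * l + 2" by (simp add: idx_Suc)
  finally have M: "card ?M \<le> 2 * l + 2" .
  have "card (forced \<inter> {a (idx k)<..a (idx (Suc k))})
      \<le> card ({a (idx k)<..a (idx k) + len k + 2} \<union> ?M)"
    by (intro card_mono forced_block) auto
  also have "\<dots> \<le> card {a (idx k)<..a (idx k) + len k + 2} + card ?M"
    by (rule card_Un_le)
  finally show ?thesis using M by simp
qed

lemma free_count_forced: "real (free_count forced p) = real p - real (card (forced \<inter> {1..p}))"
proof -
  have "card ({1..p} - forced) = card {1..p} - card ({1..p} \<inter> forced)"
    by (rule card_Diff_subset_Int) simp
  moreover have "card ({1..p} \<inter> forced) \<le> card {1..p}" by (intro card_mono) auto
  ultimately show ?thesis by (simp add: free_count_def Int_commute of_nat_diff)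
qed

text \<open>Here \<alpha> bounds the share of forced positions in a full period, and \<kappa> bounds
  the forced positions of the current period relative to its start \<open>u\<close>. The worst case
  is the end of a block, near \<open>(1 + \<kappa>) * u\<close>, with about
  \<open>(1 - \<alpha>) * u\<close> free positions before it.\<close>

lemma free_count_forced_ge:
  assumes t: "0 \<le> t" "t * (1 + \<kappa>) \<le> 1 - \<alpha>" and nonneg: "0 \<le> \<alpha>" "0 \<le> \<kappa>"
    and len_\<alpha>: "\<And>k. real (len k + 2 * l + 4) \<le> \<alpha> * (real (a (idx (Suc k))) - real (a (idx k)))"
    and len_\<kappa>: "\<And>k. real (len k + 2 * l + 4) \<le> \<kappa> * real (a (idx k))"
  shows "t * real p \<le> real (free_count forced p) + real (a (idx 0))"
proof -
  define h where "h p = card (forced \<inter> {1..p})" for p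
  let ?u = "\<lambda>k. a (idx k)"
  have h_split: "h q = h p + card (forced \<inter> {p<..q})" if "p \<le> q" for p q
  proof -
    have "forced \<inter> {1..q} = (forced \<inter> {1..p}) \<union> (forced \<inter> {p<..q})" using that by auto
    then show ?thesis unfolding h_def by (simp only:) (rule card_Un_disjoint, auto)
  qed
  have h_le: "h p \<le> p" for p
    using card_mono[of "{1..p}" "forced \<inter> {1..p}"] by (simp add: h_def)
  have "t * (1 + \<kappa>) \<ge> t" using t nonneg by (simp add: distrib_left)
  then have t1: "t \<le> 1" using t nonneg by linarith
  \<comment> \<open>The summand \<open>?u 0\<close> pays for the positions before the first block,
    where the density is not controlled.\<close>
  have h_u: "real (h (?u k)) \<le> \<alpha> * ?u k + ?u 0" for k
  proof (induction k)
    case 0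
    have "real (h (?u 0)) \<le> ?u 0" using h_le[of "?u 0"] by simp
    then show ?case using nonneg by (simp add: add_increasing)
  next
    case (Suc k)
    have "?u k \<le> ?u (Suc k)" using block_end[of k "Suc k"] by simp
    then have "real (h (?u (Suc k))) \<le> real (h (?u k)) + real (len k + 2 * l + 4)"
      using h_split[of "?u k" "?u (Suc k)"] card_forced_block[of k] by simp
    then show ?case using Suc len_\<alpha>[of k] by (simp add: algebra_simps)
  qed
  have "t * real p \<le> real p - real (h p) + ?u 0"
  proof (cases "p \<le> ?u 0")
    case True
    have "t * real p \<le> real p" using t1 by (simp add: mult_left_le_one_le t)
    then show ?thesis using True h_le[of p] by linarith
  next
    case False
    then obtain k where k: "?u k \<le> p" "p < ?u (Suc k)"
      using strict_mono_block[OF a_idx_strict, of p] by auto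
    define w where "w = card (forced \<inter> {?u k<..p})"
    have "w \<le> card {?u k<..p}" unfolding w_def by (intro card_mono) auto
    then have w1: "w \<le> p - ?u k" by simp
    have "w \<le> card (forced \<inter> {?u k<..?u (Suc k)})"
      unfolding w_def using k by (intro card_mono) auto
    then have "real w \<le> real (len k + 2 * l + 4)" using card_forced_block[of k] by linarith
    then have w2: "real w \<le> \<kappa> * ?u k" using len_\<kappa>[of k] by simp
    have "real (h p) \<le> \<alpha> * ?u k + ?u 0 + w"
      using h_split[OF k(1)] h_u[of k] by (simp add: w_def)
    moreover have "t * real p + \<alpha> * ?u k + w \<le> p"
    proof -
      \<comment> \<open>\<open>r\<close> counts the free positions of the current period up to
        \<open>p\<close>. As \<open>t \<le> 1\<close>, they only help, which reduces the claim to
        \<open>r = 0\<close>.\<close>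
      define r where "r = real p - real (?u k) - real w"
      have r: "0 \<le> r" using w1 k by (simp add: r_def)
      have p: "real p = ?u k + w + r" by (simp add: r_def)
      have "t * real w \<le> t * (\<kappa> * ?u k)" using w2 t by (intro mult_left_mono)
      moreover have "t * r \<le> r" using t1 r t by (simp add: mult_left_le_one_le)
      moreover have "t * (1 + \<kappa>) * ?u k \<le> (1 - \<alpha>) * ?u k"
        using t by (intro mult_right_mono) auto
      ultimately show ?thesis unfolding p by (simp add: algebra_simps)
    qed
    ultimately show ?thesis by linarith
  qed
  then show ?thesis by (simp add: free_count_forced h_def)
qed

end

section \<open>The exponent of numbers with admissible digits\<close>

locale admissible_digits = zero_blocks + digit_expansion +
  assumes admissible: "\<And>p. p \<in> forced \<Longrightarrow> d p = forced_digit p"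
begin

definition \<xi> :: real where
  "\<xi> = digit_tail b d 0"

lemma marker_digits:
  assumes "i \<notin> zeros" "Suc i \<notin> zeros" "i \<in> markers" "Suc i \<in> markers"
  shows "\<exists>p\<in>{i, Suc i}. d p \<noteq> 0" "\<exists>p\<in>{i, Suc i}. d p \<noteq> b - 1"
proof -
  have "d i = int (i mod 2)" "d (Suc i) = int (Suc i mod 2)"
    using assms admissible[of i] admissible[of "Suc i"] by (auto simp: forced_def forced_digit_def)
  then have "d i = 0 \<and> d (Suc i) = 1 \<or> d i = 1 \<and> d (Suc i) = 0"
    by (cases "even i") (auto simp: mod2_eq_if)
  then show "\<exists>p\<in>{i, Suc i}. d p \<noteq> 0" "\<exists>p\<in>{i, Suc i}. d p \<noteq> b - 1"
    using base by auto
qed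

lemma infdist_ge_marker:
  assumes "i \<notin> zeros" "Suc i \<notin> zeros" "i \<in> markers" "Suc i \<in> markers"
    and "m < i" "Suc i \<le> m + L"
  shows "1 / of_int b ^ L \<le> infdist (of_int b ^ m * \<xi>) \<int>"
proof -
  obtain p q where "p \<in> {i, Suc i}" "d p \<noteq> 0" "q \<in> {i, Suc i}" "d q \<noteq> b - 1"
    using marker_digits[OF assms(1-4)] by blast
  then show ?thesis
    using assms(5,6) unfolding \<xi>_def by (intro infdist_power_mult_ge[of "p - m" _ _ "q - m"]) auto
qed

text \<open>Either both markers right after \<open>a n\<close> survive, or they meet a zero block
  \<open>j\<close> with \<open>j \<le> k\<close>. That block starts no later than
  \<open>a n\<close>, so its end markers lie within \<open>len j + 2\<close> places of
  \<open>a n\<close>.\<close>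

lemma infdist_ge:
  assumes n: "1 \<le> n" "n < idx (Suc k)"
  shows "1 / of_int b ^ (len k + 2) \<le> infdist (of_int b ^ a n * \<xi>) \<int>"
proof (cases "a n + 1 \<in> zeros \<or> a n + 2 \<in> zeros")
  case False
  then show ?thesis
    using n by (intro infdist_ge_marker[of "a n + 1"]) (auto simp: markers_def)
next
  case True
  then obtain j where "a n + 1 \<in> {a (idx j)<..a (idx j) + len j} \<or>
      a n + 2 \<in> {a (idx j)<..a (idx j) + len j}"
    unfolding zeros_def by blast
  then have j: "a (idx j) < a n + 2" "a n + 1 \<le> a (idx j) + len j" by auto
  \<comment> \<open>The bounds so far would still allow \<open>a n\<close> to lie just before the
    block; \<open>before_idx\<close> rules this out.\<close>
  have "idx j \<le> n" using before_idx[of n j] j n by (meson not_le)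
  then have a: "a (idx j) \<le> a n" using idx_ge by (intro a_le)
  have "idx j < idx (Suc k)" using \<open>idx j \<le> n\<close> n by simp
  then have "j \<le> k" using strict_mono_less[OF idx_strict] by simp
  then have "len j \<le> len k" by (rule len_mono)
  then show ?thesis
    using j a after_block_not_zeros[of _ j]
    by (intro infdist_ge_marker[of "a (idx j) + len j + 1"]) (auto simp: markers_def)
qed

lemma infdist_block_le: "infdist (of_int b ^ a (idx k) * \<xi>) \<int> \<le> 1 / of_int b ^ len k"
proof -
  have "d i = 0" if "a (idx k) < i" "i \<le> a (idx k) + len k" for i
  proof -
    have "i \<in> zeros" using that by (auto simp: zeros_def)
    then show ?thesis using admissible[of i] by (simp add: forced_def forced_digit_def)
  qed
  then have "digit_tail b d (a (idx k)) \<le> 1 / of_int b ^ len k" by (rule digit_tail_zeros)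
  then show ?thesis using infdist_power_mult_le[of "a (idx k)"] by (simp add: \<xi>_def)
qed

text \<open>For the upper bound, at the last index \<open>idx k + l\<close> of a period no multiple
  is closer to an integer than \<open>b^(-(len k + 2))\<close>, and \<open>len k\<close> is
  \<open>v * a (idx k + l)\<close> up to rounding. For the lower bound, \<open>a (idx k)\<close>
  alone serves every index of the period.\<close>

lemma vhat_eq: "vhat b a \<xi> = ereal v"
proof (rule antisym)
  let ?m = "\<lambda>N. MIN n\<in>{1..N}. infdist (of_int b ^ a n * \<xi>) \<int>"
  have b1: "1 < real_of_int b" using base by simp
  show "vhat b a \<xi> \<le> ereal v"
    unfolding vhat_def
  proof (rule Sup_least, clarify)
    fix w assume w: "0 \<le> w"
      "\<forall>\<^sub>F N in sequentially. ?m N < (of_int b ^ a N) powr (- w)"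
    show "ereal w \<le> ereal v"
    proof (rule ccontr)
      assume "\<not> ereal w \<le> ereal v"
      then have wv: "0 < w - v" by simp
      obtain M where M: "\<And>N. M \<le> N \<Longrightarrow> ?m N < (of_int b ^ a N) powr (- w)"
        using w(2) by (auto simp: eventually_sequentially)
      \<comment> \<open>The 3 collects the two marker digits and the rounding in
        \<open>len\<close>.\<close>
      obtain c :: nat where c: "3 / (w - v) < real c" using reals_Archimedean2 by blast
      define k where "k = M + c + 1"
      define n where "n = idx k + l"
      have k_le: "k \<le> idx k" by (rule strict_mono_imp_increasing[OF idx_strict])
      have "c + 1 \<le> n" using k_le by (simp add: n_def k_def)
      then have "c \<le> a n" using a_ge[of c] a_le[of "c + 1" n] by simp
      have "real_of_int b powr (- real (len k + 2)) \<le> ?m n"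
      proof (rule Min.boundedI)
        fix y assume "y \<in> (\<lambda>n. infdist (of_int b ^ a n * \<xi>) \<int>) ` {1..n}"
        then obtain i where i: "1 \<le> i" "i \<le> n" "y = infdist (of_int b ^ a i * \<xi>) \<int>" by auto
        have "1 / of_int b ^ (len k + 2) \<le> y"
          unfolding i(3) using i by (intro infdist_ge) (auto simp: idx_Suc n_def)
        moreover have "real_of_int b powr (- real (len k + 2)) = 1 / of_int b ^ (len k + 2)"
          using b1 by (simp only: powr_minus_divide powr_realpow)
        ultimately show "real_of_int b powr (- real (len k + 2)) \<le> y" by simp
      qed (use idx_ge[of k] in \<open>auto simp: n_def\<close>)
      also have "?m n < (of_int b ^ a n) powr (- w)"
        using k_le by (intro M) (simp add: n_def k_def)
      also have "(of_int b ^ a n) powr (- w) = real_of_int b powr (- (w * a n))"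
        using b1 by (simp add: powr_realpow[symmetric] powr_powr mult.commute)
      finally have "w * a n < len k + 2" using b1 by simp
      moreover have "len k \<le> v * a n + 1" using len_bounds(2)[of k] by (simp add: n_def)
      ultimately have "(w - v) * a n < 3" by (simp add: algebra_simps)
      moreover have "3 < (w - v) * c" using c wv by (simp add: field_simps)
      moreover have "(w - v) * c \<le> (w - v) * a n" using wv \<open>c \<le> a n\<close> by simp
      ultimately show False by linarith
    qed
  qed
  show "ereal v \<le> vhat b a \<xi>"
  proof (rule dense_le)
    fix x assume x: "x < ereal v"
    \<comment> \<open>The supremum ranges over nonnegative reals, so a negative or infinite
      \<open>x\<close> is replaced by 0.\<close>
    define w where "w = (if x \<le> 0 then 0 else real_of_ereal x)"
    have w: "0 \<le> w" "w < v" "x \<le> ereal w"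
      using x v_pos by (cases x; simp add: w_def)+
    have "\<forall>\<^sub>F n in sequentially. ?m n < (of_int b ^ a n) powr (- w)"
      unfolding eventually_sequentially
    proof (intro exI allI impI)
      fix n assume "idx 0 \<le> n"
      then obtain k where k: "idx k \<le> n" "n < idx (Suc k)"
        using strict_mono_block[OF idx_strict] by blast
      have n: "1 \<le> n" using k idx_ge[of k] by linarith
      have "0 < a n"
        using gap[of N] a_le[of "Suc N" n] k idx_ge[of k] by simp
      have "a n \<le> a (idx k + l)" using k n by (intro a_le) (auto simp: idx_Suc)
      then have "w * a n < v * a n" "v * a n \<le> v * a (idx k + l)"
        using w v_pos \<open>0 < a n\<close> by auto
      then have "w * a n < len k" using len_bounds(1)[of k] by linarith
      have "?m n \<le> infdist (of_int b ^ a (idx k) * \<xi>) \<int>"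
        using k idx_ge[of k] by (intro Min_le) auto
      also have "\<dots> \<le> 1 / of_int b ^ len k" by (rule infdist_block_le)
      also have "\<dots> = real_of_int b powr (- real (len k))"
        using b1 by (simp add: powr_minus_divide powr_realpow)
      also have "\<dots> < real_of_int b powr (- (w * a n))"
        using b1 \<open>w * a n < len k\<close> by simp
      also have "\<dots> = (of_int b ^ a n) powr (- w)"
        using b1 by (simp add: powr_realpow[symmetric] powr_powr mult.commute)
      finally show "?m n < (of_int b ^ a n) powr (- w)" .
    qed
    then have "ereal w \<le> vhat b a \<xi>"
      unfolding vhat_def using w by (intro Sup_upper) auto
    then show "x \<le> vhat b a \<xi>" using w by simp
  qed
qed

end

section \<open>Positive measure from the spreading map\<close>

context zero_blocks
begin

lemma forced_digit_bounds: "0 \<le> forced_digit p" "forced_digit p < b"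
proof -
  have "p mod 2 < 2" by simp
  then have "int (p mod 2) < 2" by linarith
  then show "0 \<le> forced_digit p" "forced_digit p < b"
    using base by (auto simp: forced_digit_def)
qed

lemma spread_in_Vhat_star:
  "digit_tail b (spread b forced forced_digit x) 0 \<in> Vhat_star b a v"
proof -
  interpret digit_expansion b "spread b forced forced_digit x"
    by (rule digit_expansion_spread) (use base forced_digit_bounds in \<open>auto simp: forced_def\<close>)
  interpret admissible_digits b a v l N "spread b forced forced_digit x"
    by unfold_locales (simp add: spread_def)
  show ?thesis using vhat_eq by (simp add: Vhat_star_def \<xi>_def)
qed

lemma hausdorff_measure_Vhat_star_neq_0:
  assumes t: "0 < t" "t * (1 + \<kappa>) \<le> 1 - \<alpha>" and nonneg: "0 \<le> \<alpha>" "0 \<le> \<kappa>"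
    and len_\<alpha>: "\<And>k. real (len k + 2 * l + 4) \<le> \<alpha> * (real (a (idx (Suc k))) - real (a (idx k)))"
    and len_\<kappa>: "\<And>k. real (len k + 2 * l + 4) \<le> \<kappa> * real (a (idx k))"
  shows "hausdorff_measure t (Vhat_star b a v) \<noteq> 0"
proof (rule hausdorff_measure_neq_0_if_expanding)
  let ?C = "real (a (idx 0))"
  show "0 < 3 * of_int b powr (1 + ?C)" using base by simp
  show "dist x y \<le> 3 * of_int b powr (1 + ?C) *
      dist (digit_tail b (spread b forced forced_digit x) 0)
        (digit_tail b (spread b forced forced_digit y) 0) powr t"
    if "x \<in> {0..<1}" "y \<in> {0..<1}" for x y
    using that t base forced_digit_bounds
    by (intro spread_holder free_count_forced_ge[OF _ t(2) nonneg len_\<alpha> len_\<kappa>])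
      (auto simp: forced_def)
  show "(\<lambda>x. digit_tail b (spread b forced forced_digit x) 0) ` {0..<1} \<subseteq> Vhat_star b a v"
    using spread_in_Vhat_star by auto
qed (rule t(1))

end


section \<open>Asymptotics of the block lengths\<close>

lemma tendsto_ratio_power:
  fixes a :: "nat \<Rightarrow> nat"
  assumes pos: "\<forall>n\<ge>1. a n > 0"
    and lim: "(\<lambda>n. real (a (Suc n)) / real (a n)) \<longlonglongrightarrow> \<eta>"
  shows "(\<lambda>n. real (a (n + j)) / real (a n)) \<longlonglongrightarrow> \<eta> ^ j"
proof (induction j)
  case 0
  have "\<forall>\<^sub>F n in sequentially. 1 = real (a (n + 0)) / real (a n)"
    unfolding eventually_sequentially using pos by (intro exI[of _ 1]) auto
  then have "(\<lambda>n. real (a (n + 0)) / real (a n)) \<longlonglongrightarrow> 1"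
    by (rule Lim_transform_eventually[OF tendsto_const])
  then show ?case by simp
next
  case (Suc j)
  have "(\<lambda>n. real (a (Suc (n + j))) / real (a (n + j))) \<longlonglongrightarrow> \<eta>"
    using LIMSEQ_ignore_initial_segment[OF lim, of j] by simp
  from tendsto_mult[OF this Suc]
  have "(\<lambda>n. real (a (Suc (n + j))) / real (a (n + j)) * (real (a (n + j)) / real (a n)))
      \<longlonglongrightarrow> \<eta> ^ Suc j" by simp
  moreover have "\<forall>\<^sub>F n in sequentially.
      real (a (Suc (n + j))) / real (a (n + j)) * (real (a (n + j)) / real (a n)) =
      real (a (n + Suc j)) / real (a n)"
    unfolding eventually_sequentially using pos by (intro exI[of _ 1]) auto
  ultimately show ?case by (rule Lim_transform_eventually)
qed

text \<open>After division by \<open>a n\<close>, each claim is a strict inequality between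
  convergent sequences that holds in the limit; the constants vanish because \<open>a n\<close>
  tends to infinity.\<close>

lemma eventually_block_lengths:
  fixes a :: "nat \<Rightarrow> nat" and c \<eta> v \<alpha> \<kappa> :: real
  assumes mono: "strict_mono_on {1..} a" and pos: "\<forall>n\<ge>1. a n > 0"
    and lim: "(\<lambda>n. real (a (Suc n)) / real (a n)) \<longlonglongrightarrow> \<eta>"
    and \<kappa>: "\<eta> ^ l * v < \<kappa>" and \<alpha>: "\<eta> ^ l * v < \<alpha> * (\<eta> ^ (l + 1) - 1)" and \<eta>: "1 < \<eta>"
  shows "\<forall>\<^sub>F n in sequentially. v * a (n + l) + c < \<kappa> * a n \<and>
    v * a (n + l) + c < \<alpha> * (real (a (n + l + 1)) - real (a n)) \<and> real (a n) + 2 < a (Suc n)"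
proof -
  have "n \<le> a (n + 1)" for n
  proof (induction n)
    case (Suc n)
    then show ?case using strict_mono_onD[OF mono, of "n + 1" "Suc n + 1"] by simp
  qed simp
  then have "filterlim (\<lambda>n. a (n + 1)) at_top sequentially"
    by (intro filterlim_at_top_mono[OF filterlim_ident]) auto
  then have "filterlim a at_top sequentially"
    by (simp add: filterlim_sequentially_Suc)
  then have "filterlim (\<lambda>n. real (a n)) at_top sequentially"
    by (rule filterlim_compose[OF filterlim_real_sequentially])
  then have inv: "(\<lambda>n. C / real (a n)) \<longlonglongrightarrow> 0" for C :: real
    by (intro real_tendsto_divide_at_top[OF tendsto_const])
  note R = tendsto_ratio_power[OF pos lim]
  have V: "(\<lambda>n. v * (a (n + l) / a n) + c / a n) \<longlonglongrightarrow> v * \<eta> ^ l + 0"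
    by (intro tendsto_intros R inv)
  have "\<forall>\<^sub>F n in sequentially. v * (a (n + l) / a n) + c / a n < \<kappa>"
    using \<kappa> by (intro order_tendstoD(2)[OF V]) (simp add: mult.commute)
  moreover have V': "(\<lambda>n. v * (a (n + l) / a n) + c / a n - \<alpha> * (a (n + (l + 1)) / a n - 1))
      \<longlonglongrightarrow> v * \<eta> ^ l + 0 - \<alpha> * (\<eta> ^ (l + 1) - 1)"
    by (intro tendsto_intros R inv)
  have "\<forall>\<^sub>F n in sequentially.
      v * (a (n + l) / a n) + c / a n - \<alpha> * (a (n + (l + 1)) / a n - 1) < 0"
    using \<alpha> by (intro order_tendstoD(2)[OF V']) (simp add: mult.commute)
  moreover have R': "(\<lambda>n. a (n + 1) / a n - 2 / a n) \<longlonglongrightarrow> \<eta> ^ 1 - 0"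
    by (intro tendsto_intros R inv)
  have "\<forall>\<^sub>F n in sequentially. 1 < a (n + 1) / a n - 2 / a n"
    using \<eta> by (intro order_tendstoD(1)[OF R']) simp
  moreover have "\<forall>\<^sub>F n in sequentially. 0 < a n"
    unfolding eventually_sequentially using pos by (intro exI[of _ 1]) auto
  ultimately show ?thesis
  proof eventually_elim
    case (elim n)
    then have pos: "real (a n) > 0" by simp
    have "v * (a (n + l) / a n) + c / a n - \<alpha> * (a (n + (l + 1)) / a n - 1) =
        (v * a (n + l) + c - \<alpha> * (real (a (n + l + 1)) - real (a n))) / a n"
      using pos by (simp add: field_simps)
    then have "v * a (n + l) + c < \<alpha> * (real (a (n + l + 1)) - real (a n))"
      using elim pos by (simp add: divide_less_0_iff)
    moreover have "v * a (n + l) + c < \<kappa> * a n" "real (a n) + 2 < a (Suc n)"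
      using elim pos by (simp_all add: field_simps)
    ultimately show ?case by simp
  qed
qed

lemma hausdorff_measure_Vhat_star:
  fixes b :: int and a :: "nat \<Rightarrow> nat" and \<eta> v t :: real
  assumes b: "b \<ge> 2" and mono: "strict_mono_on {1..} a" and pos: "\<forall>n\<ge>1. a n > 0"
    and lim: "(\<lambda>n. real (a (Suc n)) / real (a n)) \<longlonglongrightarrow> \<eta>"
    and \<eta>: "1 < \<eta>" and v: "0 < v"
    and t: "0 < t" "t * (1 + \<eta> ^ l * v) < 1 - \<eta> ^ l * v / (\<eta> ^ (l + 1) - 1)"
  shows "hausdorff_measure t (Vhat_star b a v) \<noteq> 0" "Vhat_star b a v \<noteq> {}"
proof -
  define w where "w = \<eta> ^ l * v"
  define E where "E = \<eta> ^ (l + 1) - 1"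
  have w: "0 < w" using \<eta> v by (simp add: w_def)
  have E: "0 < E" using \<eta> one_less_power[of \<eta> "l + 1"] by (simp add: E_def)
  \<comment> \<open>The slack in the hypothesis on \<open>t\<close>. Half of it enlarges the
    limiting value \<open>w\<close> to \<kappa> and half enlarges \<open>w / E\<close> to \<alpha>;
    since \<open>t < 1\<close>, the two together use up no more than \<delta>.\<close>
  define \<delta> where "\<delta> = 1 - w / E - t * (1 + w)"
  have \<delta>: "0 < \<delta>" using t by (simp add: \<delta>_def w_def E_def)
  define \<kappa> where "\<kappa> = w + \<delta> / 2"
  define \<alpha> where "\<alpha> = w / E + \<delta> / 2"
  have "0 < w / E" "0 < t * w" using w E t by simp_all
  then have "t < 1" using \<delta> by (simp add: \<delta>_def distrib_left)
  then have "t * (\<delta> / 2) \<le> \<delta> / 2" using \<delta> by simp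
  moreover have "t * (1 + \<kappa>) = t * (1 + w) + t * (\<delta> / 2)"
    by (simp add: \<kappa>_def algebra_simps)
  moreover have "1 - \<alpha> = t * (1 + w) + \<delta> / 2"
    unfolding \<alpha>_def by (subst (2) \<delta>_def, simp add: \<delta>_def field_simps)
  ultimately have t\<kappa>: "t * (1 + \<kappa>) \<le> 1 - \<alpha>" by simp
  have "0 < t * (1 + \<kappa>)" using t w \<delta> by (simp add: \<kappa>_def)
  then have \<alpha>: "0 < \<alpha>" "\<alpha> < 1" using t\<kappa> \<open>0 < w / E\<close> \<delta> by (auto simp: \<alpha>_def)
  have "\<alpha> * E = w + \<delta> / 2 * E" using E by (simp add: \<alpha>_def field_simps)
  then have "w < \<alpha> * E" using \<delta> E by simp
  \<comment> \<open>The constant is the \<open>2 * l + 4\<close> of \<open>card_forced_block\<close>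
    plus 1 for the ceiling in \<open>len\<close>.\<close>
  then have "\<forall>\<^sub>F n in sequentially. v * a (n + l) + (2 * l + 5) < \<kappa> * a n \<and>
    v * a (n + l) + (2 * l + 5) < \<alpha> * (real (a (n + l + 1)) - real (a n)) \<and>
    real (a n) + 2 < a (Suc n)"
    using \<delta> by (intro eventually_block_lengths[OF mono pos lim _ _ \<eta>]) (simp_all add: \<kappa>_def w_def E_def)
  then obtain M where M: "\<And>n. M \<le> n \<Longrightarrow> v * a (n + l) + (2 * l + 5) < \<kappa> * a n"
    "\<And>n. M \<le> n \<Longrightarrow> v * a (n + l) + (2 * l + 5) < \<alpha> * (real (a (n + l + 1)) - real (a n))"
    "\<And>n. M \<le> n \<Longrightarrow> real (a n) + 2 < a (Suc n)"
    by (auto simp: eventually_sequentially)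
  have len: "real (nat \<lceil>v * a (n + l)\<rceil> + 2 * l + 4) \<le> v * a (n + l) + (2 * l + 5)" for n
  proof -
    have "0 \<le> v * a (n + l)" using v by simp
    then have "real (nat \<lceil>v * a (n + l)\<rceil>) = of_int \<lceil>v * a (n + l)\<rceil>" by simp
    then have "real (nat \<lceil>v * a (n + l)\<rceil>) \<le> v * a (n + l) + 1" by linarith
    then show ?thesis by simp
  qed
  define N where "N = M + 1"
  interpret zero_blocks b a v l N
  proof
    fix n assume n: "N \<le> n"
    show "a n + 2 \<le> a (Suc n)" using M(3)[of n] n by (simp add: N_def)
    let ?D = "real (a (n + l + 1)) - real (a n)"
    have "0 \<le> ?D"
      using strict_mono_on_leD[OF mono, of n "n + l + 1"] n by (simp add: N_def)
    \<comment> \<open>Since \<open>\<alpha> < 1\<close>, the density estimate already implies that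
      the blocks fit between consecutive starts.\<close>
    then have "\<alpha> * ?D \<le> ?D" using \<alpha> by (simp add: mult_left_le_one_le)
    then have "real (nat \<lceil>v * a (n + l)\<rceil> + 2 * l + 4) \<le> ?D"
      using len[of n] M(2)[of n] n by (simp add: N_def)
    then show "a n + nat \<lceil>v * a (n + l)\<rceil> + 2 \<le> a (n + l + 1)" by linarith
  qed (use b v mono in \<open>auto simp: N_def\<close>)
  show "Vhat_star b a v \<noteq> {}" using spread_in_Vhat_star by blast
  have M_idx: "M \<le> idx k" for k using idx_ge(1)[of k] by (simp add: N_def)
  show "hausdorff_measure t (Vhat_star b a v) \<noteq> 0"
  proof (rule hausdorff_measure_Vhat_star_neq_0[OF t(1) t\<kappa>])
    show "0 \<le> \<alpha>" "0 \<le> \<kappa>" using \<alpha> w \<delta> by (simp_all add: \<kappa>_def)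
    show "real (len k + 2 * l + 4) \<le> \<alpha> * (real (a (idx (Suc k))) - real (a (idx k)))" for k
      using len[of "idx k"] M(2)[OF M_idx, of k] by (simp add: len_def idx_Suc)
    show "real (len k + 2 * l + 4) \<le> \<kappa> * real (a (idx k))" for k
      using len[of "idx k"] M(1)[OF M_idx, of k] by (simp add: len_def)
  qed
qed

text \<open>The exponent plus one exceeds the quotient of logarithms, so
  \<open>\<eta> ^ (ltilde \<eta> v + 1) * (\<eta> - v)\<close> exceeds \<open>\<eta> + 1\<close> and
  hence \<eta>; dividing by \<eta> gives the claim.\<close>

lemma ltilde_gt:
  assumes \<eta>: "1 < \<eta>" and v: "v < \<eta>"
  shows "1 < \<eta> ^ ltilde \<eta> v * (\<eta> - v)"
proof -
  let ?l = "ltilde \<eta> v"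
  let ?q = "(ln (\<eta> + 1) - ln (\<eta> - v)) / ln \<eta>"
  have "int ?l \<ge> \<lfloor>?q\<rfloor>" unfolding ltilde_def by linarith
  then have "?q < real ?l + 1" by linarith
  then have "ln (\<eta> + 1) - ln (\<eta> - v) < (real ?l + 1) * ln \<eta>"
    using \<eta> by (simp add: divide_less_eq)
  then have "ln (\<eta> + 1) < ln (\<eta> ^ (?l + 1) * (\<eta> - v))"
    using \<eta> v by (simp add: ln_mult_pos ln_realpow distrib_right)
  then have "\<eta> + 1 < \<eta> ^ (?l + 1) * (\<eta> - v)"
    using \<eta> v by (subst (asm) ln_less_cancel_iff) auto
  then have "\<eta> * 1 < \<eta> * (\<eta> ^ ?l * (\<eta> - v))" by (simp add: mult.assoc)
  then show ?thesis using \<eta> by (subst (asm) mult_less_cancel_left_pos) auto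
qed

theorem theorem1p3:
  fixes b :: int and a :: "nat \<Rightarrow> nat" and \<eta> v :: real
  assumes "b \<ge> 2"
    and "strict_mono_on {1..} a"
    and "\<forall>n\<ge>1. a n > 0"
    and "(\<lambda>n. real (a (Suc n)) / real (a n)) \<longlonglongrightarrow> \<eta>"
    and "1 < \<eta>"
    and "0 < v" and "v < \<eta>"
  shows "hausdorff_dim (Vhat_star b a v) \<ge>
    ereal ((\<eta> ^ (ltilde \<eta> v + 1) - 1 - \<eta> ^ ltilde \<eta> v * v) /
           ((\<eta> ^ (ltilde \<eta> v + 1) - 1) * (1 + \<eta> ^ ltilde \<eta> v * v)))"
proof -
  define l where "l = ltilde \<eta> v"
  define w where "w = \<eta> ^ l * v"
  define E where "E = \<eta> ^ (l + 1) - 1"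
  define s where "s = (E - w) / (E * (1 + w))"
  have w: "0 < w" using assms by (simp add: w_def)
  \<comment> \<open>This rearranges \<open>ltilde_gt\<close> and makes the bound \<open>s\<close>
    positive.\<close>
  have "w < E" using ltilde_gt[of \<eta> v] assms by (simp add: w_def E_def l_def algebra_simps)
  then have E: "0 < E" using w by simp
  have "s * (1 + w) = (E - w) / E" using w by (simp add: s_def)
  \<comment> \<open>So \<open>s\<close> is the threshold at which the condition on \<open>t\<close>
    in \<open>hausdorff_measure_Vhat_star\<close> becomes an equality.\<close>
  then have s_eq: "s * (1 + w) = 1 - w / E" using E by (simp add: diff_divide_distrib)
  have s: "0 < s" unfolding s_def using \<open>w < E\<close> w E by (intro divide_pos_pos mult_pos_pos) auto
  have t: "t * (1 + \<eta> ^ l * v) < 1 - \<eta> ^ l * v / (\<eta> ^ (l + 1) - 1)" if "t < s" for t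
  proof -
    have "t * (1 + w) < s * (1 + w)" using that w by (intro mult_strict_right_mono) auto
    then show ?thesis using s_eq by (simp add: w_def E_def)
  qed
  have "ereal s \<le> hausdorff_dim (Vhat_star b a v)"
  proof (rule hausdorff_dim_geI)
    show "Vhat_star b a v \<noteq> {}"
      using s by (intro hausdorff_measure_Vhat_star(2)[OF assms(1-6) _ t[of "s / 2"]]) auto
    show "hausdorff_measure t (Vhat_star b a v) \<noteq> 0" if "0 < t" "t < s" for t
      using that by (intro hausdorff_measure_Vhat_star(1)[OF assms(1-6) _ t]) auto
  qed
  then show ?thesis by (simp add: s_def E_def w_def l_def)
qed

end
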